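(* In the single-buyer-type setting described in the context, let $$\mathcal G=\big\{\{i,j\}: i,j\in\mathcal H_a\text{ for some }a\in A,\ (R(i)-R(j))(C(i)-C(j))\le 0\big\}$$ (pairs with $i=j$ allowed). Then the following convex program, in variables $\gamma_{ij},\gamma_{ji}$ for $\{i,j\}\in\mathcal G$, finds an optimal advertising rule: $$\max\ \sum_{\{i,j\}\in\mathcal G}\Big[\gamma_{ij}R(i)C(i)+\gamma_{ji}R(j)C(j)-\frac{\gamma_{ij}\gamma_{ji}}{\gamma_{ij}+\gamma_{ji}}\,(R(i)-R(j))(C(i)-C(j))\Big]$$ $$\text{s.t.}\quad \sum_{\{i,j\}\in\mathcal G}\big(\gamma_{ij}\, i+\gamma_{ji}\, j\big)=\theta,\qquad \gamma\ge 0 .$$ That is, this is a convex program (maximization of a concave function under linear constraints), and an optimal solution $\gamma$ yields an optimal advertising rule by taking, for each $\{i,j\}\in\mathcal G$ with $\gamma_{ij}+\gamma_{ji}>0$, one signal $s$ with $\phi_s=\gamma_{ij}+\gamma_{ji}$ and $\phi_s\,\eta^s=\gamma_{ij}\,i+\gamma_{ji}\,j$.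
   Context: Setting (single buyer type). $\Omega=\{1,\dots,n\}$ is the set of states, $\Delta\Omega$ the set of probability distributions on $\Omega$, $\mu\in\Delta\Omega$ the distribution of the state, $\theta\in\Delta\Omega$ the buyer's prior belief with $\theta_\omega>0$ for all $\omega$, $A$ a finite action set, $u:\Omega\times A\to[0,1]$ the utility. For $\eta\in\Delta\Omega$: $C_a(\eta)=\sum_\omega\eta_\omega\big(\max_{a'\in A}u(\omega,a')-u(\omega,a)\big)$; cost of uncertainty $C(\eta)=\min_{a\in A}C_a(\eta)$; likelihood ratio $R(\eta)=\sum_\omega\mu_\omega\eta_\omega/\theta_\omega$. For $a\in A$, $\mathcal P_a=\{\eta\in\Delta\Omega: C_a(\eta)\le C_{a'}(\eta)\ \forall a'\in A\}$, a (possibly empty) polytope, and $\mathcal H_a$ is the set of vertices of $\mathcal P_a$; elements $i\in\mathcal H_a$ are vectors in $\Delta\Omega$. An advertising rule consists of a finite signal set $S$, a signaling scheme $\pi:\Omega\to\Delta S$ and prices $p_s$, $s\in S$. The buyer's posterior after $s$ is $\eta^s_\omega=\theta_\omega\pi(\omega,s)/\sum_{\omega'}\theta_{\omega'}\pi(\omega',s)$, and $\phi_s=\sum_\omega\theta_\omega\pi(\omega,s)$ is the probability of $s$ from the buyer's viewpoint. The buyer purchases full revelation of $\omega$ iff $C(\eta^s)\ge p_s$; the seller's expected revenue is $\sum_\omega\mu_\omega\sum_s\pi(\omega,s)p_s\mathbf 1(C(\eta^s)\ge p_s)$, and a rule is optimal if it maximizes this over all rules. Data $(S,(\phi_s),(\eta^s))$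 with $\phi_s\ge0$, $\eta^s\in\Delta\Omega$, $\sum_s\phi_s\eta^s=\theta$ determine the rule $\pi(\omega,s)=\phi_s\eta^s_\omega/\theta_\omega$, $p_s=C(\eta^s)$. Convention: the fraction $\gamma_{ij}\gamma_{ji}/(\gamma_{ij}+\gamma_{ji})$ is $0$ when $\gamma_{ij}=\gamma_{ji}=0$. *)

theory Defs
  imports "HOL-Analysis.Analysis" "HOL-Library.Function_Algebras"
begin

text \<open>The library has no vector space structure on function types.  The pointwise one lets
  \<^const>\<open>concave_on\<close> and \<^const>\<open>linear\<close> apply to the variables
  \<open>\<gamma> i j\<close> of the convex program.\<close>

instantiation "fun" :: (type, real_vector) real_vector
begin

definition scaleR_fun :: "real \<Rightarrow> ('a \<Rightarrow> 'b) \<Rightarrow> 'a \<Rightarrow> 'b"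
  where "scaleR_fun r f = (\<lambda>x. r *\<^sub>R f x)"

instance
  by standard (auto simp: scaleR_fun_def plus_fun_def scaleR_add_right scaleR_add_left)

end

text \<open>The states form a finite type \<open>'n\<close>; \<open>A\<close> is the set of actions and \<open>u\<close> the utility.\<close>

definition beliefs :: "(real ^ 'n) set"
  where "beliefs = {\<eta>. (\<forall>\<omega>. 0 \<le> \<eta> $ \<omega>) \<and> (\<Sum>\<omega>\<in>UNIV. \<eta> $ \<omega>) = 1}"

definition action_cost :: "'a set \<Rightarrow> ('n::finite \<Rightarrow> 'a \<Rightarrow> real) \<Rightarrow> 'a \<Rightarrow> real ^ 'n \<Rightarrow> real"
  where "action_cost A u a \<eta> = (\<Sum>\<omega>\<in>UNIV. \<eta> $ \<omega> * (Max (u \<omega> ` A) - u \<omega> a))"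

definition cost :: "'a set \<Rightarrow> ('n::finite \<Rightarrow> 'a \<Rightarrow> real) \<Rightarrow> real ^ 'n \<Rightarrow> real"
  where "cost A u \<eta> = Min ((\<lambda>a. action_cost A u a \<eta>) ` A)"

definition likelihood_ratio :: "real ^ 'n \<Rightarrow> real ^ 'n \<Rightarrow> real ^ 'n \<Rightarrow> real"
  where "likelihood_ratio \<mu> \<theta> \<eta> = (\<Sum>\<omega>\<in>UNIV. \<mu> $ \<omega> * \<eta> $ \<omega> / \<theta> $ \<omega>)"

definition best_region :: "'a set \<Rightarrow> ('n::finite \<Rightarrow> 'a \<Rightarrow> real) \<Rightarrow> 'a \<Rightarrow> (real ^ 'n) set"
  where "best_region A u a =
    {\<eta> \<in> beliefs. \<forall>a'\<in>A. action_cost A u a \<eta> \<le> action_cost A u a' \<eta>}"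

definition region_vertices :: "'a set \<Rightarrow> ('n::finite \<Rightarrow> 'a \<Rightarrow> real) \<Rightarrow> 'a \<Rightarrow> (real ^ 'n) set"
  where "region_vertices A u a = {i. i extreme_point_of best_region A u a}"


text \<open>A rule is given by its signals \<open>S\<close>, its scheme \<open>\<pi>\<close> and its prices; the prices are arbitrary
  reals.\<close>

definition signaling_scheme :: "'s set \<Rightarrow> ('n::finite \<Rightarrow> 's \<Rightarrow> real) \<Rightarrow> bool"
  where "signaling_scheme S \<pi> \<longleftrightarrow>
    finite S \<and> (\<forall>\<omega>. (\<forall>s\<in>S. 0 \<le> \<pi> \<omega> s) \<and> (\<Sum>s\<in>S. \<pi> \<omega> s) = 1)"

definition signal_prob :: "real ^ 'n \<Rightarrow> ('n \<Rightarrow> 's \<Rightarrow> real) \<Rightarrow> 's \<Rightarrow> real"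
  where "signal_prob \<theta> \<pi> s = (\<Sum>\<omega>\<in>UNIV. \<theta> $ \<omega> * \<pi> \<omega> s)"

text \<open>If \<open>signal_prob \<theta> \<pi> s = 0\<close> then the posterior is the zero vector; for positive
  \<open>\<theta>\<close> such a signal is never sent and so does not affect the revenue.\<close>

definition posterior :: "real ^ 'n \<Rightarrow> ('n \<Rightarrow> 's \<Rightarrow> real) \<Rightarrow> 's \<Rightarrow> real ^ 'n"
  where "posterior \<theta> \<pi> s = (\<chi> \<omega>. \<theta> $ \<omega> * \<pi> \<omega> s / signal_prob \<theta> \<pi> s)"

definition revenue ::
  "'a set \<Rightarrow> ('n::finite \<Rightarrow> 'a \<Rightarrow> real) \<Rightarrow> real ^ 'n \<Rightarrow> real ^ 'n \<Rightarrow>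
   's set \<Rightarrow> ('n \<Rightarrow> 's \<Rightarrow> real) \<Rightarrow> ('s \<Rightarrow> real) \<Rightarrow> real"
  where "revenue A u \<mu> \<theta> S \<pi> p =
    (\<Sum>\<omega>\<in>UNIV. \<mu> $ \<omega> *
      (\<Sum>s\<in>S. \<pi> \<omega> s * p s * of_bool (cost A u (posterior \<theta> \<pi> s) \<ge> p s)))"

text \<open>The competing rules have their signals in \<open>'t\<close>.  A definition cannot quantify over types, so
  \<open>'t\<close> is a parameter, to be left arbitrary where optimality is asserted.\<close>

definition optimal_rule ::
  "'t itself \<Rightarrow> 'a set \<Rightarrow> ('n::finite \<Rightarrow> 'a \<Rightarrow> real) \<Rightarrow> real ^ 'n \<Rightarrow> real ^ 'n \<Rightarrow>
   's set \<Rightarrow> ('n \<Rightarrow> 's \<Rightarrow> real) \<Rightarrow> ('s \<Rightarrow> real) \<Rightarrow> bool"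
  where "optimal_rule T A u \<mu> \<theta> S \<pi> p \<longleftrightarrow>
    signaling_scheme S \<pi> \<and>
    (\<forall>(S' :: 't set) \<pi>' p'. signaling_scheme S' \<pi>' \<longrightarrow>
       revenue A u \<mu> \<theta> S' \<pi>' p' \<le> revenue A u \<mu> \<theta> S \<pi> p)"

definition scheme_of_data ::
  "real ^ 'n \<Rightarrow> ('s \<Rightarrow> real) \<Rightarrow> ('s \<Rightarrow> real ^ 'n) \<Rightarrow> 'n \<Rightarrow> 's \<Rightarrow> real"
  where "scheme_of_data \<theta> \<phi> \<eta> \<omega> s = \<phi> s * \<eta> s $ \<omega> / \<theta> $ \<omega>"

definition prices_of_data ::
  "'a set \<Rightarrow> ('n::finite \<Rightarrow> 'a \<Rightarrow> real) \<Rightarrow> ('s \<Rightarrow> real ^ 'n) \<Rightarrow> 's \<Rightarrow> real"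
  where "prices_of_data A u \<eta> s = cost A u (\<eta> s)"


text \<open>An unordered pair \<open>{i, j}\<close> is a set with at most two elements; \<open>on_pair f {i, j}\<close> is the
  common value of \<open>f i j\<close> and \<open>f j i\<close>, for a symmetric \<open>f\<close>.\<close>

definition on_pair :: "('v \<Rightarrow> 'v \<Rightarrow> 'b) \<Rightarrow> 'v set \<Rightarrow> 'b"
  where "on_pair f e = (THE z. \<exists>i j. e = {i, j} \<and> z = f i j)"

lemma on_pair_eq:
  assumes "\<And>x y. f x y = f y x"
  shows "on_pair f {i, j} = f i j"
  unfolding on_pair_def
proof (rule the_equality)
  fix z assume "\<exists>x y. {i, j} = {x, y} \<and> z = f x y"
  then obtain x y where "{i, j} = {x, y}" and z: "z = f x y" by blast
  then consider "x = i" "y = j" | "x = j" "y = i" by (auto simp: doubleton_eq_iff)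
  then show "z = f i j" using z assms[of i j] by cases simp_all
qed blast

definition program_pairs ::
  "'a set \<Rightarrow> ('n::finite \<Rightarrow> 'a \<Rightarrow> real) \<Rightarrow> real ^ 'n \<Rightarrow> real ^ 'n \<Rightarrow> (real ^ 'n) set set"
  where "program_pairs A u \<mu> \<theta> =
    {{i, j} | i j. \<exists>a\<in>A. i \<in> region_vertices A u a \<and> j \<in> region_vertices A u a \<and>
       (likelihood_ratio \<mu> \<theta> i - likelihood_ratio \<mu> \<theta> j) * (cost A u i - cost A u j) \<le> 0}"

text \<open>The variable \<open>\<gamma> i j\<close> is the weight of \<open>i\<close> in the pair \<open>{i, j}\<close>, so a pair \<open>{i, i}\<close> has
  the single variable \<open>\<gamma> i i\<close>, counted twice.  The values \<open>\<gamma> i j\<close> with \<open>{i, j}\<close> not in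
  \<open>program_pairs\<close> occur nowhere.  With \<open>0 / 0 = 0\<close>, the fraction
  \<open>\<gamma> i j * \<gamma> j i / (\<gamma> i j + \<gamma> j i)\<close> is \<open>0\<close> when both weights are \<open>0\<close>.\<close>

definition pair_weight :: "('v \<Rightarrow> 'v \<Rightarrow> real) \<Rightarrow> 'v set \<Rightarrow> real"
  where "pair_weight \<gamma> = on_pair (\<lambda>i j. \<gamma> i j + \<gamma> j i)"

definition pair_vector :: "(real ^ 'n \<Rightarrow> real ^ 'n \<Rightarrow> real) \<Rightarrow> (real ^ 'n) set \<Rightarrow> real ^ 'n"
  where "pair_vector \<gamma> = on_pair (\<lambda>i j. \<gamma> i j *\<^sub>R i + \<gamma> j i *\<^sub>R j)"

definition pair_value ::
  "'a set \<Rightarrow> ('n::finite \<Rightarrow> 'a \<Rightarrow> real) \<Rightarrow> real ^ 'n \<Rightarrow> real ^ 'n \<Rightarrow>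
   (real ^ 'n \<Rightarrow> real ^ 'n \<Rightarrow> real) \<Rightarrow> (real ^ 'n) set \<Rightarrow> real"
  where "pair_value A u \<mu> \<theta> \<gamma> =
    (let R = likelihood_ratio \<mu> \<theta>; C = cost A u in
     on_pair (\<lambda>i j. \<gamma> i j * R i * C i + \<gamma> j i * R j * C j
       - \<gamma> i j * \<gamma> j i / (\<gamma> i j + \<gamma> j i) * ((R i - R j) * (C i - C j))))"

definition program_objective ::
  "'a set \<Rightarrow> ('n::finite \<Rightarrow> 'a \<Rightarrow> real) \<Rightarrow> real ^ 'n \<Rightarrow> real ^ 'n \<Rightarrow>
   (real ^ 'n \<Rightarrow> real ^ 'n \<Rightarrow> real) \<Rightarrow> real"
  where "program_objective A u \<mu> \<theta> \<gamma> = (\<Sum>e\<in>program_pairs A u \<mu> \<theta>. pair_value A u \<mu> \<theta> \<gamma> e)"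

definition program_total ::
  "'a set \<Rightarrow> ('n::finite \<Rightarrow> 'a \<Rightarrow> real) \<Rightarrow> real ^ 'n \<Rightarrow> real ^ 'n \<Rightarrow>
   (real ^ 'n \<Rightarrow> real ^ 'n \<Rightarrow> real) \<Rightarrow> real ^ 'n"
  where "program_total A u \<mu> \<theta> \<gamma> = (\<Sum>e\<in>program_pairs A u \<mu> \<theta>. pair_vector \<gamma> e)"

definition program_nonneg ::
  "'a set \<Rightarrow> ('n::finite \<Rightarrow> 'a \<Rightarrow> real) \<Rightarrow> real ^ 'n \<Rightarrow> real ^ 'n \<Rightarrow>
   (real ^ 'n \<Rightarrow> real ^ 'n \<Rightarrow> real) set"
  where "program_nonneg A u \<mu> \<theta> = {\<gamma>. \<forall>i j. {i, j} \<in> program_pairs A u \<mu> \<theta> \<longrightarrow> 0 \<le> \<gamma> i j}"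

definition program_feasible ::
  "'a set \<Rightarrow> ('n::finite \<Rightarrow> 'a \<Rightarrow> real) \<Rightarrow> real ^ 'n \<Rightarrow> real ^ 'n \<Rightarrow>
   (real ^ 'n \<Rightarrow> real ^ 'n \<Rightarrow> real) set"
  where "program_feasible A u \<mu> \<theta> =
    {\<gamma> \<in> program_nonneg A u \<mu> \<theta>. program_total A u \<mu> \<theta> \<gamma> = \<theta>}"

definition program_solution ::
  "'a set \<Rightarrow> ('n::finite \<Rightarrow> 'a \<Rightarrow> real) \<Rightarrow> real ^ 'n \<Rightarrow> real ^ 'n \<Rightarrow>
   (real ^ 'n \<Rightarrow> real ^ 'n \<Rightarrow> real) \<Rightarrow> bool"
  where "program_solution A u \<mu> \<theta> \<gamma> \<longleftrightarrow>
    \<gamma> \<in> program_feasible A u \<mu> \<theta> \<and>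
    (\<forall>\<gamma>'\<in>program_feasible A u \<mu> \<theta>.
       program_objective A u \<mu> \<theta> \<gamma>' \<le> program_objective A u \<mu> \<theta> \<gamma>)"

text \<open>The data read off from \<open>\<gamma>\<close>: the signals are the pairs of positive weight themselves.\<close>

definition program_signals ::
  "'a set \<Rightarrow> ('n::finite \<Rightarrow> 'a \<Rightarrow> real) \<Rightarrow> real ^ 'n \<Rightarrow> real ^ 'n \<Rightarrow>
   (real ^ 'n \<Rightarrow> real ^ 'n \<Rightarrow> real) \<Rightarrow> (real ^ 'n) set set"
  where "program_signals A u \<mu> \<theta> \<gamma> = {e \<in> program_pairs A u \<mu> \<theta>. pair_weight \<gamma> e > 0}"

definition program_posterior :: "(real ^ 'n \<Rightarrow> real ^ 'n \<Rightarrow> real) \<Rightarrow> (real ^ 'n) set \<Rightarrow> real ^ 'n"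
  where "program_posterior \<gamma> e = (1 / pair_weight \<gamma> e) *\<^sub>R pair_vector \<gamma> e"


text \<open>The sums over \<open>program_pairs\<close> are sums over a finite set.\<close>

lemma finite_region_vertices:
  assumes "finite A"
  shows "finite (region_vertices A u a)"
proof -
  have le: "action_cost A u a \<eta> \<le> action_cost A u a' \<eta> \<longleftrightarrow>
      (\<chi> \<omega>. u \<omega> a' - u \<omega> a) \<bullet> \<eta> \<le> 0" for \<eta> a'
  proof -
    have "action_cost A u a \<eta> - action_cost A u a' \<eta> = (\<chi> \<omega>. u \<omega> a' - u \<omega> a) \<bullet> \<eta>"
      unfolding action_cost_def inner_vec_def sum_subtractf[symmetric]
      by (intro sum.cong) (simp_all add: algebra_simps)
    then show ?thesis by linarith
  qed
  have eq: "best_region A u a =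
      \<Inter> (range (\<lambda>\<omega>. {\<eta>. axis \<omega> 1 \<bullet> \<eta> \<ge> 0})) \<inter> {\<eta>. (\<chi> \<omega>. 1) \<bullet> \<eta> = 1} \<inter>
      \<Inter> ((\<lambda>a'. {\<eta>. (\<chi> \<omega>. u \<omega> a' - u \<omega> a) \<bullet> \<eta> \<le> 0}) ` A)"
    unfolding best_region_def beliefs_def le
    by (auto simp: inner_axis' inner_vec_def[of "\<chi> \<omega>. 1"])
  have "polyhedron (best_region A u a)"
    unfolding eq using assms
    by (intro polyhedron_Int polyhedron_Inter)
       (auto simp: polyhedron_halfspace_le polyhedron_halfspace_ge polyhedron_hyperplane)
  then show ?thesis
    unfolding region_vertices_def by (rule finite_polyhedron_extreme_points)
qed

lemma finite_program_pairs:
  assumes "finite A"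
  shows "finite (program_pairs A u \<mu> \<theta>)"
proof (rule finite_subset)
  show "program_pairs A u \<mu> \<theta> \<subseteq> Pow (\<Union>a\<in>A. region_vertices A u a)"
    by (auto simp: program_pairs_def)
  show "finite (Pow (\<Union>a\<in>A. region_vertices A u a))"
    using assms by (simp add: finite_region_vertices)
qed

end

theory Submission
  imports Defs
begin

text \<open>The revenue of a rule is at most \<open>\<Sum>s. \<phi> s * f (\<eta> s)\<close> for \<open>f = R * C\<close>, with equality for
  the prices \<open>C (\<eta> s)\<close>, so the seller looks for the best splitting of \<open>\<theta>\<close> with respect to \<open>f\<close>.
  On the region of an action \<open>C\<close> is linear and \<open>f\<close> is a product of two linear functions.  Hence a
  posterior that is a mixture of three or more vertices of the region may be split without loss
  along a direction on which \<open>R\<close> is constant, until at most two vertices remain.  On the segment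
  between two vertices \<open>f\<close> is convex unless \<open>R\<close> and \<open>C\<close> are oppositely ordered there, so the other
  segments may be split into their endpoints.  What is left is a feasible point of the program,
  whose objective is the revenue of the corresponding rule.  Concavity of the objective comes from
  that of \<open>x * y / (x + y)\<close>, which is homogeneous of degree \<open>1\<close> and superadditive.\<close>

section \<open>Evaluation on doubletons\<close>

lemma pair_weight_doubleton: "pair_weight \<gamma> {i, j} = \<gamma> i j + \<gamma> j i"
  unfolding pair_weight_def by (rule on_pair_eq) simp

lemma pair_vector_doubleton: "pair_vector \<gamma> {i, j} = \<gamma> i j *\<^sub>R i + \<gamma> j i *\<^sub>R j"
  unfolding pair_vector_def by (rule on_pair_eq) simp

lemma pair_value_doubleton:
  "pair_value A u \<mu> \<theta> \<gamma> {i, j} =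
     \<gamma> i j * likelihood_ratio \<mu> \<theta> i * cost A u i + \<gamma> j i * likelihood_ratio \<mu> \<theta> j * cost A u j
     - \<gamma> i j * \<gamma> j i / (\<gamma> i j + \<gamma> j i) *
       ((likelihood_ratio \<mu> \<theta> i - likelihood_ratio \<mu> \<theta> j) * (cost A u i - cost A u j))"
  unfolding pair_value_def Let_def by (rule on_pair_eq) (simp add: algebra_simps)

section \<open>The fraction \<open>x * y / (x + y)\<close>\<close>

text \<open>After the denominators are cleared, the right side exceeds the left by the square
  \<open>(x * y' - x' * y)\<^sup>2\<close>. If one of the two sums is 0, both of its terms are 0 and
  the two sides agree.\<close>

lemma parallel_sum_superadditive:
  fixes x y x' y' :: real
  assumes "0 \<le> x" "0 \<le> y" "0 \<le> x'" "0 \<le> y'"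
  shows "x * y / (x + y) + x' * y' / (x' + y') \<le> (x + x') * (y + y') / (x + x' + (y + y'))"
proof (cases "x + y = 0 \<or> x' + y' = 0")
  case True
  then have "x = 0 \<and> y = 0 \<or> x' = 0 \<and> y' = 0"
    using assms by linarith
  then show ?thesis by auto
next
  case False
  then have pos: "0 < x + y" "0 < x' + y'" using assms by linarith+
  then have pos': "0 < x + x' + (y + y')" by linarith
  have "x * y / (x + y) + x' * y' / (x' + y') =
      (x * y * (x' + y') + x' * y' * (x + y)) / ((x + y) * (x' + y'))"
    using pos by (intro add_frac_eq) auto
  also have "\<dots> \<le> (x + x') * (y + y') / (x + x' + (y + y'))"
  proof -
    have "(x + x') * (y + y') * ((x + y) * (x' + y'))
        - (x * y * (x' + y') + x' * y' * (x + y)) * (x + x' + (y + y')) = (x * y' - x' * y)\<^sup>2"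
      by algebra
    then have "(x * y * (x' + y') + x' * y' * (x + y)) * (x + x' + (y + y'))
        \<le> (x + x') * (y + y') * ((x + y) * (x' + y'))"
      by (smt (verit) zero_le_power2)
    then show ?thesis
      using mult_pos_pos[OF pos] pos' by (simp only: divide_le_eq le_divide_eq pos_divide_le_eq
          pos_le_divide_eq times_divide_eq_left if_True)
  qed
  finally show ?thesis .
qed

text \<open>Only common zeros of \<open>f\<close> and \<open>g\<close> need care. There the value is
  \<open>0 / 0 = 0\<close>, and nearby the fraction is squeezed between 0 and \<open>f\<close>,
  which tends to 0.\<close>

lemma continuous_on_parallel_sum:
  fixes f g :: "'a::topological_space \<Rightarrow> real"
  assumes cont: "continuous_on K f" "continuous_on K g"
    and nonneg: "\<And>x. x \<in> K \<Longrightarrow> 0 \<le> f x" "\<And>x. x \<in> K \<Longrightarrow> 0 \<le> g x"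
  shows "continuous_on K (\<lambda>x. f x * g x / (f x + g x))"
  unfolding continuous_on_def
proof
  fix a assume a: "a \<in> K"
  have lim: "(f \<longlongrightarrow> f a) (at a within K)" "(g \<longlongrightarrow> g a) (at a within K)"
    using cont a by (auto simp: continuous_on_def)
  show "((\<lambda>x. f x * g x / (f x + g x)) \<longlongrightarrow> f a * g a / (f a + g a)) (at a within K)"
  proof (cases "f a + g a = 0")
    case False
    then show ?thesis by (intro tendsto_intros lim)
  next
    case True
    then have fa: "f a = 0" using nonneg[OF a] by linarith
    have K: "\<forall>\<^sub>F x in at a within K. x \<in> K"
      by (simp add: eventually_at_filter)
    have "((\<lambda>x. f x * g x / (f x + g x)) \<longlongrightarrow> 0) (at a within K)"
    proof (rule tendsto_sandwich)
      show "\<forall>\<^sub>F x in at a within K. 0 \<le> f x * g x / (f x + g x)"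
        using K by eventually_elim (simp add: nonneg)
      show "\<forall>\<^sub>F x in at a within K. f x * g x / (f x + g x) \<le> f x"
        using K
      proof eventually_elim
        case (elim x)
        have "f x * g x / (f x + g x) = f x * (g x / (f x + g x))" by simp
        also have "\<dots> \<le> f x * 1"
          using nonneg[OF elim] by (intro mult_left_mono) (auto simp: divide_simps)
        finally show ?case by simp
      qed
      show "(f \<longlongrightarrow> 0) (at a within K)" using lim fa by simp
    qed simp
    then show ?thesis using True by simp
  qed
qed

section \<open>Compact products and convex hulls\<close>

text \<open>Tychonoff's theorem, in the product topology on the function type.\<close>

lemma compact_pointwise:
  fixes S :: "'a \<Rightarrow> 'b::topological_space set"
  assumes "\<And>i. compact (S i)"
  shows "compact {f. \<forall>i. f i \<in> S i}"
proof -
  have "compactin (product_topology (\<lambda>i. euclidean) UNIV) (PiE UNIV S)"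
    using assms by (simp add: compactin_PiE)
  moreover have "PiE UNIV S = {f. \<forall>i. f i \<in> S i}" by auto
  ultimately show ?thesis by (simp add: euclidean_product_topology)
qed

lemma convex_hull_remove_zero_weight:
  assumes "finite S" "v0 \<in> S" "w v0 = 0" "\<And>v. v \<in> S \<Longrightarrow> 0 \<le> w v" "sum w S = 1"
  shows "(\<Sum>v\<in>S. w v *\<^sub>R v) \<in> convex hull (S - {v0})"
proof -
  have "sum w (S - {v0}) = 1" "(\<Sum>v\<in>S - {v0}. w v *\<^sub>R v) = (\<Sum>v\<in>S. w v *\<^sub>R v)"
    using assms by (simp_all add: sum.remove[OF assms(1,2)])
  then show ?thesis
    using assms by (auto simp: convex_hull_finite intro!: exI[of _ w])
qed

text \<open>As \<open>c\<close> sums to 0, the weights \<open>w v + t * c v\<close> keep the sum 1,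
  and as \<open>c\<close> does not vanish on \<open>S\<close>, some coefficient is negative. So
  growing \<open>t\<close> drives some weight to 0. Only the coefficients matter: the direction
  itself may be the zero vector if \<open>S\<close> is affinely dependent.\<close>

lemma convex_hull_exit:
  assumes fin: "finite S" and w: "\<And>v. v \<in> S \<Longrightarrow> 0 < w v" "sum w S = 1"
    and c: "sum c S = 0" "\<exists>v\<in>S. c v \<noteq> 0"
  obtains t v where "0 < t" "v \<in> S"
    "(\<Sum>v\<in>S. w v *\<^sub>R v) + t *\<^sub>R (\<Sum>v\<in>S. c v *\<^sub>R v) \<in> convex hull (S - {v})"
proof -
  define N where "N = {v \<in> S. c v < 0}"
  have "N \<noteq> {}"
  proof
    assume "N = {}"
    then have "\<forall>v\<in>S. 0 \<le> c v" by (force simp: N_def)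
    then have "\<forall>v\<in>S. c v = 0" using c(1) fin by (simp add: sum_nonneg_eq_0_iff)
    then show False using c(2) by simp
  qed
  moreover have "finite N" using fin by (simp add: N_def)
  ultimately obtain v0 where v0: "v0 \<in> N" "\<And>v. v \<in> N \<Longrightarrow> w v0 / - c v0 \<le> w v / - c v"
    using arg_min_if_finite[of N "\<lambda>v. w v / - c v"] by (metis not_le)
  \<comment> \<open>The ratio test: the first \<open>t\<close> at which some weight becomes
    0.\<close>
  define t where "t = w v0 / - c v0"
  have t: "0 < t" using v0(1) w(1) by (simp add: t_def N_def divide_pos_neg)
  have "0 \<le> w v + t * c v" if v: "v \<in> S" for v
  proof (cases "c v < 0")
    case True
    then have "t \<le> w v / - c v" using v0(2) v by (simp add: t_def N_def)
    then have "t * - c v \<le> w v" using True by (simp add: field_simps)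
    then show ?thesis by simp
  next
    case False
    then show ?thesis using t w(1)[OF v] by (simp add: add_nonneg_nonneg less_imp_le)
  qed
  moreover have "w v0 + t * c v0 = 0" using v0(1) by (simp add: t_def N_def)
  moreover have "(\<Sum>v\<in>S. w v + t * c v) = 1"
    using w(2) c(1) by (simp add: sum.distrib flip: sum_distrib_left)
  ultimately have "(\<Sum>v\<in>S. (w v + t * c v) *\<^sub>R v) \<in> convex hull (S - {v0})"
    using v0(1) fin by (intro convex_hull_remove_zero_weight) (auto simp: N_def)
  then have "(\<Sum>v\<in>S. w v *\<^sub>R v) + t *\<^sub>R (\<Sum>v\<in>S. c v *\<^sub>R v) \<in> convex hull (S - {v0})"
    by (simp add: scaleR_add_left sum.distrib scaleR_sum_right)
  with t v0(1) show ?thesis by (intro that) (auto simp: N_def)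
qed

section \<open>Beliefs, regions and costs\<close>

lemma linear_action_cost: "linear (action_cost A u a)"
  by (rule linearI)
    (simp_all add: action_cost_def algebra_simps sum.distrib sum_subtractf sum_distrib_left)

lemma linear_likelihood_ratio: "linear (likelihood_ratio \<mu> \<theta>)"
  by (rule linearI)
    (simp_all add: likelihood_ratio_def algebra_simps add_divide_distrib sum.distrib sum_distrib_left)

lemma convex_beliefs: "convex (beliefs :: (real ^ 'n) set)"
  unfolding beliefs_def
  by (rule convexI) (auto simp: sum.distrib simp flip: sum_distrib_left)

lemma compact_beliefs: "compact (beliefs :: (real ^ 'n) set)"
proof -
  have "closed (beliefs :: (real ^ 'n) set)"
    unfolding beliefs_def
    by (intro closed_Collect_conj closed_Collect_all closed_Collect_le closed_Collect_eq
        continuous_intros)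
  moreover have "norm \<eta> \<le> 1" if "\<eta> \<in> beliefs" for \<eta> :: "real ^ 'n"
    using norm_le_l1_cart[of \<eta>] that by (simp add: beliefs_def)
  ultimately show ?thesis
    by (auto simp: compact_eq_bounded_closed bounded_iff)
qed

lemma convex_best_region: "convex (best_region A u a)"
proof -
  have "best_region A u a = beliefs \<inter>
      (\<Inter>a'\<in>A. {\<eta>. action_cost A u a \<eta> - action_cost A u a' \<eta> \<le> 0})"
    by (auto simp: best_region_def)
  moreover have "convex {\<eta>. action_cost A u a \<eta> - action_cost A u a' \<eta> \<le> 0}" for a'
  proof -
    have "linear (\<lambda>\<eta>. action_cost A u a \<eta> - action_cost A u a' \<eta>)"
      by (intro linear_compose_sub linear_action_cost)
    then have "convex ((\<lambda>\<eta>. action_cost A u a \<eta> - action_cost A u a' \<eta>) -` {..0})"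
      by (rule convex_linear_vimage) (rule convex_real_interval)
    then show ?thesis by (simp add: vimage_def)
  qed
  ultimately show ?thesis
    by (auto intro!: convex_Int convex_INT convex_beliefs)
qed

lemma compact_best_region: "compact (best_region A u a)"
proof -
  have "closed {\<eta>. action_cost A u a \<eta> \<le> action_cost A u a' \<eta>}" for a'
    by (intro closed_Collect_le linear_continuous_on linear_linear[THEN iffD2] linear_action_cost)
  then have "compact (beliefs \<inter> (\<Inter>a'\<in>A. {\<eta>. action_cost A u a \<eta> \<le> action_cost A u a' \<eta>}))"
    by (intro compact_Int_closed compact_beliefs closed_INT) auto
  moreover have "best_region A u a =
      beliefs \<inter> (\<Inter>a'\<in>A. {\<eta>. action_cost A u a \<eta> \<le> action_cost A u a' \<eta>})"
    by (auto simp: best_region_def)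
  ultimately show ?thesis by simp
qed

text \<open>Minkowski's theorem for compact convex sets. It makes every posterior in a region a
  mixture of the points over which the program ranges.\<close>

lemma best_region_eq_convex_hull: "best_region A u a = convex hull (region_vertices A u a)"
  unfolding region_vertices_def
  by (intro Krein_Milman_Minkowski compact_best_region convex_best_region)

lemma region_vertices_subset: "region_vertices A u a \<subseteq> best_region A u a"
  by (auto simp: region_vertices_def extreme_point_of_def)

lemma best_region_subset_beliefs: "best_region A u a \<subseteq> beliefs"
  by (auto simp: best_region_def)

lemma cost_best_region:
  assumes "finite A" "a \<in> A" "\<eta> \<in> best_region A u a"
  shows "cost A u \<eta> = action_cost A u a \<eta>"
  using assms unfolding cost_def best_region_def by (intro Min_eqI) auto

lemma beliefs_best_region:
  assumes "finite A" "A \<noteq> {}" "\<eta> \<in> beliefs"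
  obtains a where "a \<in> A" "\<eta> \<in> best_region A u a"
proof -
  obtain a where "a \<in> A" "\<And>a'. a' \<in> A \<Longrightarrow> action_cost A u a \<eta> \<le> action_cost A u a' \<eta>"
    using arg_min_if_finite[of A "\<lambda>a. action_cost A u a \<eta>"] assms by (metis not_le)
  then show ?thesis using assms by (intro that) (auto simp: best_region_def)
qed

text \<open>Needed for prices that the buyer refuses: they earn 0, which must not exceed the cost.
  Only nonnegative coordinates are assumed, so that the zero posterior of a signal of probability 0
  is covered.\<close>

lemma cost_nonneg:
  assumes "finite A" "A \<noteq> {}" "\<And>\<omega>. 0 \<le> \<eta> $ \<omega>"
  shows "0 \<le> cost A u \<eta>"
  unfolding cost_def action_cost_def using assms
  by (auto simp: Min_ge_iff intro!: sum_nonneg mult_nonneg_nonneg)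

text \<open>The sign of the last term decides whether splitting the mixture into \<open>x\<close>
  and \<open>y\<close> gains or loses. With \<open>s\<close> and \<open>t\<close> the normalized
  weights of a pair, this term times the total weight is the fractional term of the
  objective.\<close>

lemma product_convex_combination:
  fixes f g :: "'v::real_vector \<Rightarrow> real"
  assumes "linear f" "linear g" "s + t = 1"
  shows "f (s *\<^sub>R x + t *\<^sub>R y) * g (s *\<^sub>R x + t *\<^sub>R y) =
    s * (f x * g x) + t * (f y * g y) - s * t * ((f x - f y) * (g x - g y))"
proof -
  have s: "s = 1 - t" using assms(3) by simp
  show ?thesis
    unfolding linear_add[OF assms(1)] linear_add[OF assms(2)]
      linear_cmul[OF assms(1)] linear_cmul[OF assms(2)] s
    by (simp add: algebra_simps)
qed

section \<open>Linearity, concavity and the value of the program\<close>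

locale advertising =
  fixes A :: "'a set" and u :: "'n::finite \<Rightarrow> 'a \<Rightarrow> real" and \<mu> \<theta> :: "real ^ 'n"
  assumes finite_actions: "finite A" and actions_nonempty: "A \<noteq> {}"
    and state_beliefs: "\<mu> \<in> beliefs"
    and prior_beliefs: "\<theta> \<in> beliefs" and prior_pos: "\<And>\<omega>. 0 < \<theta> $ \<omega>"
begin

abbreviation "R \<equiv> likelihood_ratio \<mu> \<theta>"
abbreviation "C \<equiv> cost A u"
abbreviation "L \<equiv> action_cost A u"
abbreviation "G \<equiv> program_pairs A u \<mu> \<theta>"
abbreviation "total_vector \<equiv> program_total A u \<mu> \<theta>"
abbreviation "objective \<equiv> program_objective A u \<mu> \<theta>"
abbreviation "nonneg \<equiv> program_nonneg A u \<mu> \<theta>"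
abbreviation "feasible \<equiv> program_feasible A u \<mu> \<theta>"

lemma finite_G: "finite G"
  using finite_actions by (rule finite_program_pairs)

lemma pairE:
  assumes "e \<in> G"
  obtains i j a where "e = {i, j}" "a \<in> A" "i \<in> region_vertices A u a" "j \<in> region_vertices A u a"
    "(R i - R j) * (C i - C j) \<le> 0"
  using assms unfolding program_pairs_def by blast

lemma nonnegD: "\<gamma> \<in> nonneg \<Longrightarrow> {i, j} \<in> G \<Longrightarrow> 0 \<le> \<gamma> i j \<and> 0 \<le> \<gamma> j i"
  by (auto simp: program_nonneg_def insert_commute)

lemma likelihood_ratio_nonneg:
  assumes "\<And>\<omega>. 0 \<le> \<eta> $ \<omega>"
  shows "0 \<le> R \<eta>"
  unfolding likelihood_ratio_def using assms state_beliefs prior_pos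
  by (auto simp: beliefs_def less_imp_le intro!: sum_nonneg divide_nonneg_nonneg mult_nonneg_nonneg)

lemma linear_total_vector: "linear total_vector"
proof -
  have "linear (\<lambda>\<gamma>. pair_vector \<gamma> e)" if "e \<in> G" for e :: "(real ^ 'n) set"
    using that
  proof (cases rule: pairE)
    case (1 i j a)
    show ?thesis
      unfolding 1(1) pair_vector_doubleton
      by (rule linearI) (simp_all add: plus_fun_def scaleR_fun_def algebra_simps)
  qed
  then have "linear (\<lambda>\<gamma>. \<Sum>e\<in>G. pair_vector \<gamma> e)"
    by (rule linear_compose_sum[rule_format])
  then show ?thesis by (simp add: program_total_def[abs_def])
qed

lemma nonneg_add: "\<gamma> \<in> nonneg \<Longrightarrow> \<gamma>' \<in> nonneg \<Longrightarrow> \<gamma> + \<gamma>' \<in> nonneg"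
  by (auto simp: program_nonneg_def plus_fun_def)

lemma nonneg_scaleR: "\<gamma> \<in> nonneg \<Longrightarrow> 0 \<le> c \<Longrightarrow> c *\<^sub>R \<gamma> \<in> nonneg"
  by (auto simp: program_nonneg_def scaleR_fun_def)

text \<open>All terms but the fraction are linear in \<open>\<gamma>\<close>. The superadditive
  fraction is multiplied by \<open>- ((R i - R j) * (C i - C j))\<close>, which is nonnegative by
  the condition that defines the pairs.\<close>

lemma objective_superadditive:
  assumes "\<gamma> \<in> nonneg" "\<gamma>' \<in> nonneg"
  shows "objective \<gamma> + objective \<gamma>' \<le> objective (\<gamma> + \<gamma>')"
  unfolding program_objective_def sum.distrib[symmetric]
proof (rule sum_mono)
  fix e assume "e \<in> G"
  then show "pair_value A u \<mu> \<theta> \<gamma> e + pair_value A u \<mu> \<theta> \<gamma>' e \<le> pair_value A u \<mu> \<theta> (\<gamma> + \<gamma>') e"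
  proof (cases rule: pairE)
    case (1 i j a)
    let ?h = "\<lambda>\<gamma>. \<gamma> i j * \<gamma> j i / (\<gamma> i j + \<gamma> j i)"
    have "{i, j} \<in> G" using \<open>e \<in> G\<close> 1 by simp
    then have "?h \<gamma> + ?h \<gamma>' \<le> ?h (\<gamma> + \<gamma>')"
      using nonnegD[OF assms(1)] nonnegD[OF assms(2)] by (simp add: plus_fun_def parallel_sum_superadditive)
    then have "?h (\<gamma> + \<gamma>') * ((R i - R j) * (C i - C j))
        \<le> (?h \<gamma> + ?h \<gamma>') * ((R i - R j) * (C i - C j))"
      using 1(5) by (rule mult_right_mono_neg)
    moreover have "(\<gamma> + \<gamma>') i j = \<gamma> i j + \<gamma>' i j" "(\<gamma> + \<gamma>') j i = \<gamma> j i + \<gamma>' j i"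
      by (simp_all add: plus_fun_def)
    ultimately show ?thesis
      unfolding 1(1) pair_value_doubleton by (simp only: distrib_right)
  qed
qed

text \<open>Each fraction is homogeneous of degree 1; for \<open>c = 0\<close> this rests on
  \<open>0 / 0 = 0\<close>.\<close>

lemma objective_scaleR: "objective (c *\<^sub>R \<gamma>) = c * objective \<gamma>"
  unfolding program_objective_def sum_distrib_left
proof (rule sum.cong[OF refl])
  fix e assume "e \<in> G"
  then show "pair_value A u \<mu> \<theta> (c *\<^sub>R \<gamma>) e = c * pair_value A u \<mu> \<theta> \<gamma> e"
  proof (cases rule: pairE)
    case (1 i j a)
    have "c * \<gamma> i j * (c * \<gamma> j i) / (c * \<gamma> i j + c * \<gamma> j i)
        = c * (\<gamma> i j * \<gamma> j i / (\<gamma> i j + \<gamma> j i))"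
      by (cases "c = 0") (simp_all flip: distrib_left)
    then show ?thesis
      unfolding 1(1) pair_value_doubleton by (simp add: scaleR_fun_def algebra_simps)
  qed
qed

lemma concave_objective: "concave_on nonneg objective"
  unfolding concave_on_iff
proof (intro conjI ballI allI impI)
  show "convex nonneg"
    by (intro convexI nonneg_add nonneg_scaleR)
  fix \<gamma> \<gamma>' and s t :: real
  assume "\<gamma> \<in> nonneg" "\<gamma>' \<in> nonneg" "0 \<le> s" "0 \<le> t"
  then show "s * objective \<gamma> + t * objective \<gamma>' \<le> objective (s *\<^sub>R \<gamma> + t *\<^sub>R \<gamma>')"
    using objective_superadditive[of "s *\<^sub>R \<gamma>" "t *\<^sub>R \<gamma>'"]
    by (simp add: nonneg_scaleR objective_scaleR)
qed

text \<open>The hypograph of the value of the program as a function of its right-hand side.  It is a convex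
  cone, as the objective is concave and homogeneous of degree \<open>1\<close>.\<close>

definition attainable :: "real ^ 'n \<Rightarrow> real \<Rightarrow> bool"
  where "attainable x z \<longleftrightarrow> (\<exists>\<gamma>\<in>nonneg. total_vector \<gamma> = x \<and> z \<le> objective \<gamma>)"

lemma attainable_add:
  assumes "attainable x z" "attainable x' z'"
  shows "attainable (x + x') (z + z')"
proof -
  obtain \<gamma> \<gamma>' where "\<gamma> \<in> nonneg" "\<gamma>' \<in> nonneg" "total_vector \<gamma> = x" "total_vector \<gamma>' = x'"
      "z \<le> objective \<gamma>" "z' \<le> objective \<gamma>'"
    using assms unfolding attainable_def by blast
  then show ?thesis
    using objective_superadditive[of \<gamma> \<gamma>'] unfolding attainable_def
    by (intro bexI[of _ "\<gamma> + \<gamma>'"]) (auto simp: linear_add[OF linear_total_vector] nonneg_add)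
qed

lemma attainable_scaleR:
  assumes "attainable x z" "0 \<le> c"
  shows "attainable (c *\<^sub>R x) (c * z)"
proof -
  obtain \<gamma> where "\<gamma> \<in> nonneg" "total_vector \<gamma> = x" "z \<le> objective \<gamma>"
    using assms(1) unfolding attainable_def by blast
  then show ?thesis
    using assms(2) unfolding attainable_def
    by (intro bexI[of _ "c *\<^sub>R \<gamma>"])
      (auto simp: linear_cmul[OF linear_total_vector] objective_scaleR nonneg_scaleR mult_left_mono)
qed

lemma attainable_mono: "attainable x z \<Longrightarrow> z' \<le> z \<Longrightarrow> attainable x z'"
  unfolding attainable_def by (meson order_trans)

lemma attainable_0: "attainable 0 0"
  unfolding attainable_def
  by (rule bexI[of _ 0])
    (use linear_0[OF linear_total_vector] objective_scaleR[of 0] in \<open>auto simp: program_nonneg_def\<close>)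

lemma attainable_sum:
  assumes "\<And>s. s \<in> S \<Longrightarrow> attainable (x s) (z s)"
  shows "attainable (sum x S) (sum z S)"
  using assms
  by (induction S rule: infinite_finite_induct) (auto intro: attainable_0 attainable_add)

lemma attainable_combination:
  assumes "attainable x z" "attainable x' z'" "0 \<le> s" "0 \<le> t"
  shows "attainable (s *\<^sub>R x + t *\<^sub>R x') (s * z + t * z')"
  using assms by (intro attainable_add attainable_scaleR)

section \<open>Attaining \<open>R * C\<close> at vertices, on segments and on regions\<close>

lemma attainable_single_pair:
  assumes "{i, j} \<in> G" "\<gamma> \<in> nonneg" "\<And>x y. {x, y} \<noteq> {i, j} \<Longrightarrow> \<gamma> x y = 0"
  shows "attainable (pair_vector \<gamma> {i, j}) (pair_value A u \<mu> \<theta> \<gamma> {i, j})"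
proof -
  have zero: "pair_vector \<gamma> e = 0 \<and> pair_value A u \<mu> \<theta> \<gamma> e = 0" if e_mem: "e \<in> G - {{i, j}}" for e
  proof -
    obtain x y where e: "e = {x, y}" using e_mem by (meson DiffD1 pairE)
    then have "\<gamma> x y = 0" "\<gamma> y x = 0" using that assms(3) by (auto simp: insert_commute)
    then show ?thesis unfolding e pair_vector_doubleton pair_value_doubleton by simp
  qed
  have "total_vector \<gamma> = pair_vector \<gamma> {i, j}" "objective \<gamma> = pair_value A u \<mu> \<theta> \<gamma> {i, j}"
    unfolding program_total_def program_objective_def
    using zero by (simp_all add: sum.remove[OF finite_G assms(1)])
  then show ?thesis using assms(2) unfolding attainable_def by auto
qed

text \<open>The weight is \<open>1/2\<close> since the variable of a pair \<open>{i, i}\<close> counts twice.\<close>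

lemma attainable_vertex:
  assumes "a \<in> A" "i \<in> region_vertices A u a"
  shows "attainable i (R i * C i)"
proof -
  let ?\<gamma> = "\<lambda>x y. if x = i \<and> y = i then 1 / 2 else 0 :: real"
  have "{i, i} \<in> G" using assms unfolding program_pairs_def by force
  then have "attainable (pair_vector ?\<gamma> {i, i}) (pair_value A u \<mu> \<theta> ?\<gamma> {i, i})"
    by (rule attainable_single_pair) (auto simp: program_nonneg_def)
  then show ?thesis
    unfolding pair_vector_doubleton pair_value_doubleton by (simp add: mult.commute flip: scaleR_add_left)
qed

text \<open>If the pair belongs to the program, its own weights \<open>s\<close> and
  \<open>t\<close> give exactly the product at the mixture. Otherwise the product is convex along
  the segment, and splitting the mixture into its endpoints does at least as well.\<close>

lemma attainable_segment:
  assumes a: "a \<in> A" and i: "i \<in> region_vertices A u a" and j: "j \<in> region_vertices A u a"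
    and st: "0 \<le> s" "0 \<le> t" "s + t = 1"
  shows "attainable (s *\<^sub>R i + t *\<^sub>R j) (R (s *\<^sub>R i + t *\<^sub>R j) * L a (s *\<^sub>R i + t *\<^sub>R j))"
proof -
  have L: "L a i = C i" "L a j = C j"
    using i j region_vertices_subset a cost_best_region finite_actions by (metis subsetD)+
  note eq = product_convex_combination[OF linear_likelihood_ratio linear_action_cost st(3)]
  show ?thesis
  \<comment> \<open>A pair with \<open>i = j\<close> has a single variable and cannot carry both
    \<open>s\<close> and \<open>t\<close>, so it is left to the splitting case, where the correction
    term is 0.\<close>
  proof (cases "i \<noteq> j \<and> (R i - R j) * (C i - C j) \<le> 0")
    case True
    let ?\<gamma> = "\<lambda>x y. if x = i \<and> y = j then s else if x = j \<and> y = i then t else 0"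
    have "{i, j} \<in> G" using a i j True unfolding program_pairs_def by blast
    then have "attainable (pair_vector ?\<gamma> {i, j}) (pair_value A u \<mu> \<theta> ?\<gamma> {i, j})"
      by (rule attainable_single_pair) (use st in \<open>auto simp: program_nonneg_def\<close>)
    then show ?thesis
      unfolding pair_vector_doubleton pair_value_doubleton eq L using True st(3) by (simp add: mult.assoc)
  next
    case False
    then have "0 \<le> s * t * ((R i - R j) * (C i - C j))" using st by auto
    moreover have "attainable (s *\<^sub>R i + t *\<^sub>R j) (s * (R i * C i) + t * (R j * C j))"
      using a i j st by (intro attainable_combination attainable_vertex)
    ultimately show ?thesis unfolding eq L by (intro attainable_mono[OF \<open>attainable _ _\<close>]) linarith
  qed
qed

text \<open>Three points carry a direction along which \<open>R\<close> is constant; \<open>R * L a\<close> is affine along it, so a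
  point in the relative interior may be split until a vertex is lost at either end.\<close>

lemma attainable_convex_hull:
  assumes "a \<in> A" "finite S" "S \<subseteq> region_vertices A u a" "x \<in> convex hull S"
  shows "attainable x (R x * L a x)"
  using assms(2-4)
proof (induction "card S" arbitrary: S x rule: less_induct)
  case less
  have IH: "attainable y (R y * L a y)" if "v \<in> S" "y \<in> convex hull (S - {v})" for v y
    using that less.prems by (intro less.hyps[of "S - {v}"]) (auto intro: card_Diff1_less simp del: card_Diff_insert)
  obtain w where w: "\<And>v. v \<in> S \<Longrightarrow> 0 \<le> w v" "sum w S = 1" "(\<Sum>v\<in>S. w v *\<^sub>R v) = x"
    using less.prems by (auto simp: convex_hull_finite)
  \<comment> \<open>A zero weight places \<open>x\<close> in the hull of fewer vertices at once; at
    most two vertices form a segment. Only the last case needs a splitting.\<close>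
  consider (zero) v where "v \<in> S" "w v = 0" | (small) "card S \<le> 2" |
    (large) "\<And>v. v \<in> S \<Longrightarrow> 0 < w v" "3 \<le> card S"
    using w(1) by (metis le_less not_less_eq_eq numeral_2_eq_2 numeral_3_eq_3)
  then show ?case
  proof cases
    case zero
    then show ?thesis
      using convex_hull_remove_zero_weight[of S v w] w less.prems by (auto intro: IH)
  next
    case small
    have "S \<noteq> {}" using w(2) by auto
    then have "card S = 1 \<or> card S = 2" using small less.prems(1) by (simp add: le_Suc_eq numeral_2_eq_2)
    then consider i where "S = {i}" | i j where "S = {i, j}" "i \<noteq> j"
      by (auto simp: card_1_singleton_iff card_2_iff)
    then show ?thesis
    proof cases
      case 1
      then show ?thesis
        using attainable_segment[of a i i 1 0] assms(1) less.prems by simp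
    next
      case 2
      then show ?thesis
        using attainable_segment[of a i j "w i" "w j"] assms(1) less.prems w by auto
    qed
  next
    case large
    obtain T where "T \<subseteq> S" "card T = 3"
      using large(2) by (meson obtain_subset_with_card_n)
    then obtain p q r where T: "T = {p, q, r}" and ne: "p \<noteq> q" "q \<noteq> r" "p \<noteq> r"
      and mem: "p \<in> S" "q \<in> S" "r \<in> S"
      by (auto simp: card_3_iff)
    \<comment> \<open>Two linear conditions on three coefficients have a nonzero solution. If
      \<open>R p = R q\<close>, it is the difference of \<open>p\<close> and \<open>q\<close>;
      otherwise, up to sign, it is the cross product of \<open>(1, 1, 1)\<close> and
      \<open>(R p, R q, R r)\<close>, whose entry at \<open>r\<close> is nonzero.\<close>
    obtain c where c: "\<exists>v\<in>T. c v \<noteq> 0" "sum c T = 0" "(\<Sum>v\<in>T. c v * R v) = 0"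
      and c0: "\<And>v. v \<notin> T \<Longrightarrow> c v = 0"
    proof (cases "R p = R q")
      case True
      show ?thesis
        by (rule that[of "\<lambda>v. if v = p then 1 else if v = q then - 1 else 0"])
          (use True ne T in auto)
    next
      case False
      show ?thesis
        by (rule that[of "\<lambda>v. if v = p then R q - R r else if v = q then R r - R p
              else if v = r then R p - R q else 0"])
          (use False ne T in \<open>auto simp: algebra_simps\<close>)
    qed
    define d where "d = (\<Sum>v\<in>S. c v *\<^sub>R v)"
    have S: "\<exists>v\<in>S. c v \<noteq> 0" "sum c S = 0" "(\<Sum>v\<in>S. c v * R v) = 0"
    proof -
      show "\<exists>v\<in>S. c v \<noteq> 0" using c(1) \<open>T \<subseteq> S\<close> by blast
      have "sum c S = sum c T" "(\<Sum>v\<in>S. c v * R v) = (\<Sum>v\<in>T. c v * R v)"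
        using less.prems(1) \<open>T \<subseteq> S\<close> c0 by (auto intro!: sum.mono_neutral_right)
      then show "sum c S = 0" "(\<Sum>v\<in>S. c v * R v) = 0" using c by simp_all
    qed
    have Rd: "R d = 0"
      using S(3) by (simp add: d_def linear_sum[OF linear_likelihood_ratio]
          linear_cmul[OF linear_likelihood_ratio])
    obtain t v where t: "0 < t" "v \<in> S" "x + t *\<^sub>R d \<in> convex hull (S - {v})"
      using convex_hull_exit[OF less.prems(1) large(1) w(2) S(2,1)] w(3) d_def by metis
    obtain s v' where s: "0 < s" "v' \<in> S" "x + s *\<^sub>R (- d) \<in> convex hull (S - {v'})"
    proof -
      have "sum (\<lambda>v. - c v) S = 0" "\<exists>v\<in>S. - c v \<noteq> 0" using S by (simp_all add: sum_negf)
      from convex_hull_exit[OF less.prems(1) large(1) w(2) this] show ?thesis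
        using that w(3) by (simp add: d_def sum_negf) blast
    qed
    let ?y = "x + t *\<^sub>R d" and ?z = "x + s *\<^sub>R (- d)"
    \<comment> \<open>The weights for which \<open>x\<close> is the mean of the two exit points:
      \<open>?k * t = ?l * s\<close>, so the direction \<open>d\<close> cancels.\<close>
    let ?k = "s / (s + t)" and ?l = "t / (s + t)"
    have pos: "0 < s + t" using s t by simp
    have "?k *\<^sub>R ?y + ?l *\<^sub>R ?z = (?k + ?l) *\<^sub>R x + (?k * t - ?l * s) *\<^sub>R d"
      by (simp add: algebra_simps)
    also have "\<dots> = x" using pos by (simp flip: add_divide_distrib)
    finally have x: "?k *\<^sub>R ?y + ?l *\<^sub>R ?z = x" .
    have "R ?y = R x" "R ?z = R x"
      using Rd by (simp_all add: linear_add[OF linear_likelihood_ratio]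
          linear_diff[OF linear_likelihood_ratio] linear_cmul[OF linear_likelihood_ratio])
    moreover have "?k * L a ?y + ?l * L a ?z = L a x"
      by (subst (3) x[symmetric])
        (simp only: linear_add[OF linear_action_cost] linear_cmul[OF linear_action_cost] real_scaleR_def)
    ultimately have val: "?k * (R ?y * L a ?y) + ?l * (R ?z * L a ?z) = R x * L a x"
      by (metis (no_types, opaque_lifting) distrib_left mult.left_commute)
    have "attainable (?k *\<^sub>R ?y + ?l *\<^sub>R ?z) (?k * (R ?y * L a ?y) + ?l * (R ?z * L a ?z))"
      using s t pos by (intro attainable_combination IH[OF t(2,3)] IH[OF s(2,3)]) simp_all
    then show ?thesis unfolding x val .
  qed
qed

section \<open>From beliefs to the revenue of an arbitrary rule\<close>

lemma attainable_belief:
  assumes "\<eta> \<in> beliefs"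
  shows "attainable \<eta> (R \<eta> * C \<eta>)"
proof -
  obtain a where a: "a \<in> A" "\<eta> \<in> best_region A u a"
    using beliefs_best_region[OF finite_actions actions_nonempty assms] .
  then have "attainable \<eta> (R \<eta> * L a \<eta>)"
    by (intro attainable_convex_hull[OF _ finite_region_vertices[OF finite_actions] subset_refl])
      (simp_all flip: best_region_eq_convex_hull)
  then show ?thesis using a by (simp add: cost_best_region finite_actions)
qed

text \<open>The posteriors split \<open>\<theta>\<close>, so the attainable values at the single
  posteriors add up to one at \<open>\<theta>\<close>. This sum bounds the revenue, because a signal
  never earns more than the cost of its posterior.\<close>

lemma attainable_revenue:
  assumes "signaling_scheme S \<pi>"
  shows "attainable \<theta> (revenue A u \<mu> \<theta> S \<pi> p)"
proof -
  define \<phi> where "\<phi> = signal_prob \<theta> \<pi>"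
  define \<eta> where "\<eta> = posterior \<theta> \<pi>"
  have fin: "finite S" and \<pi>: "\<And>\<omega> s. s \<in> S \<Longrightarrow> 0 \<le> \<pi> \<omega> s" "\<And>\<omega>. (\<Sum>s\<in>S. \<pi> \<omega> s) = 1"
    using assms by (auto simp: signaling_scheme_def)
  have nn: "0 \<le> \<theta> $ \<omega> * \<pi> \<omega> s" if "s \<in> S" for \<omega> s
    using that \<pi>(1) prior_pos by (simp add: less_imp_le)
  \<comment> \<open>If \<open>\<phi> s = 0\<close>, all terms of that sum of nonnegative numbers
    vanish, so the identity holds whatever the posterior is.\<close>
  have joint: "\<phi> s * \<eta> s $ \<omega> = \<theta> $ \<omega> * \<pi> \<omega> s" if "s \<in> S" for s \<omega>
  proof (cases "\<phi> s = 0")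
    case True
    then have "\<theta> $ \<omega> * \<pi> \<omega> s = 0"
      using nn[OF that] by (simp add: \<phi>_def signal_prob_def sum_nonneg_eq_0_iff)
    then show ?thesis using True by simp
  next
    case False
    then show ?thesis by (simp add: \<eta>_def posterior_def \<phi>_def)
  qed
  have \<phi>: "0 \<le> \<phi> s" if "s \<in> S" for s
    using nn[OF that] by (auto simp: \<phi>_def signal_prob_def intro: sum_nonneg)
  have \<eta>: "0 \<le> \<eta> s $ \<omega>" if "s \<in> S" for s \<omega>
    using nn[OF that] \<phi>[OF that] by (simp add: \<eta>_def posterior_def \<phi>_def)
  have att: "attainable (\<phi> s *\<^sub>R \<eta> s) (\<phi> s * (R (\<eta> s) * C (\<eta> s)))" if "s \<in> S" for s
  proof (cases "\<phi> s = 0")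
    case True
    then show ?thesis by (simp add: attainable_0)
  next
    case False
    have "(\<Sum>\<omega>\<in>UNIV. \<eta> s $ \<omega>) = 1"
      using False by (simp add: \<eta>_def posterior_def \<phi>_def signal_prob_def flip: sum_divide_distrib)
    then have "\<eta> s \<in> beliefs" using \<eta>[OF that] by (simp add: beliefs_def)
    then show ?thesis by (intro attainable_scaleR attainable_belief \<phi>[OF that])
  qed
  have "(\<Sum>s\<in>S. \<phi> s *\<^sub>R \<eta> s) = \<theta>"
    by (simp add: vec_eq_iff joint \<pi>(2) flip: sum_distrib_left)
  with attainable_sum[of S "\<lambda>s. \<phi> s *\<^sub>R \<eta> s", OF att] have
    "attainable \<theta> (\<Sum>s\<in>S. \<phi> s * (R (\<eta> s) * C (\<eta> s)))" by simp
  moreover have "revenue A u \<mu> \<theta> S \<pi> p \<le> (\<Sum>s\<in>S. \<phi> s * (R (\<eta> s) * C (\<eta> s)))"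
  proof -
    have "revenue A u \<mu> \<theta> S \<pi> p =
        (\<Sum>s\<in>S. \<Sum>\<omega>\<in>UNIV. \<mu> $ \<omega> * (\<pi> \<omega> s * p s * of_bool (p s \<le> C (\<eta> s))))"
      unfolding revenue_def \<eta>_def sum_distrib_left by (rule sum.swap)
    also have "\<dots> \<le> (\<Sum>s\<in>S. \<phi> s * (R (\<eta> s) * C (\<eta> s)))"
    proof (rule sum_mono)
      fix s assume s: "s \<in> S"
      \<comment> \<open>Change of measure: \<open>R\<close> converts the buyer's probability of the
        signal into its probability under \<open>\<mu>\<close>.\<close>
      have "\<phi> s * R (\<eta> s) = (\<Sum>\<omega>\<in>UNIV. \<mu> $ \<omega> * \<pi> \<omega> s)"
        unfolding likelihood_ratio_def sum_distrib_left
      proof (rule sum.cong[OF refl])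
        fix \<omega>
        have "\<phi> s * (\<mu> $ \<omega> * \<eta> s $ \<omega> / \<theta> $ \<omega>) = \<mu> $ \<omega> * (\<phi> s * \<eta> s $ \<omega>) / \<theta> $ \<omega>"
          by simp
        also have "\<dots> = \<mu> $ \<omega> * \<pi> \<omega> s"
          using prior_pos[of \<omega>] by (simp add: joint[OF s])
        finally show "\<phi> s * (\<mu> $ \<omega> * \<eta> s $ \<omega> / \<theta> $ \<omega>) = \<mu> $ \<omega> * \<pi> \<omega> s" .
      qed
      then have "(\<Sum>\<omega>\<in>UNIV. \<mu> $ \<omega> * (\<pi> \<omega> s * p s * of_bool (p s \<le> C (\<eta> s)))) =
          \<phi> s * R (\<eta> s) * (p s * of_bool (p s \<le> C (\<eta> s)))"
        by (simp add: sum_distrib_right mult.assoc)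
      also have "\<dots> \<le> \<phi> s * R (\<eta> s) * C (\<eta> s)"
        using \<phi>[OF s] likelihood_ratio_nonneg[OF \<eta>[OF s]]
          cost_nonneg[OF finite_actions actions_nonempty \<eta>[OF s]]
        by (intro mult_left_mono) auto
      finally show "(\<Sum>\<omega>\<in>UNIV. \<mu> $ \<omega> * (\<pi> \<omega> s * p s * of_bool (p s \<le> C (\<eta> s)))) \<le>
          \<phi> s * (R (\<eta> s) * C (\<eta> s))" by (simp add: mult.assoc)
    qed
    finally show ?thesis .
  qed
  ultimately show ?thesis by (rule attainable_mono)
qed

section \<open>The rule given by a feasible point\<close>

text \<open>Both vertices lie in one convex region, so the posterior does too, and there the cost is
  the linear cost of one action. The product formula then applies; multiplying it by the total
  weight turns \<open>s * t\<close> into the fraction. For \<open>i = j\<close> both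
  \<open>s\<close> and \<open>t\<close> are \<open>1/2\<close>.\<close>

lemma pair_posterior:
  assumes "\<gamma> \<in> nonneg" "e \<in> G" "pair_weight \<gamma> e > 0"
  shows "program_posterior \<gamma> e \<in> beliefs"
    and "pair_weight \<gamma> e * (R (program_posterior \<gamma> e) * C (program_posterior \<gamma> e)) =
      pair_value A u \<mu> \<theta> \<gamma> e"
proof -
  obtain i j a where e: "e = {i, j}" and a: "a \<in> A"
    and ij: "i \<in> region_vertices A u a" "j \<in> region_vertices A u a"
    using assms(2) by (auto elim: pairE)
  define s where "s = \<gamma> i j / (\<gamma> i j + \<gamma> j i)"
  define t where "t = \<gamma> j i / (\<gamma> i j + \<gamma> j i)"
  have W: "0 < \<gamma> i j + \<gamma> j i" using assms(3) unfolding e pair_weight_doubleton .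
  have "0 \<le> \<gamma> i j" "0 \<le> \<gamma> j i" using nonnegD[OF assms(1)] assms(2) e by auto
  then have st: "0 \<le> s" "0 \<le> t" "s + t = 1"
    using W by (simp_all add: s_def t_def flip: add_divide_distrib)
  have post: "program_posterior \<gamma> e = s *\<^sub>R i + t *\<^sub>R j"
    by (simp add: program_posterior_def e pair_weight_doubleton pair_vector_doubleton s_def t_def
        scaleR_add_right)
  have ij': "i \<in> best_region A u a" "j \<in> best_region A u a"
    using ij region_vertices_subset[of A u a] by auto
  then have mem: "s *\<^sub>R i + t *\<^sub>R j \<in> best_region A u a"
    using st by (intro convexD convex_best_region)
  then show "program_posterior \<gamma> e \<in> beliefs"
    using best_region_subset_beliefs[of A u a] post by auto
  have L: "C (s *\<^sub>R i + t *\<^sub>R j) = L a (s *\<^sub>R i + t *\<^sub>R j)" "L a i = C i" "L a j = C j"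
    using cost_best_region[OF finite_actions a, of _ u] mem ij' by simp_all
  have mult: "(\<gamma> i j + \<gamma> j i) * s = \<gamma> i j" "(\<gamma> i j + \<gamma> j i) * t = \<gamma> j i"
    using W by (simp_all add: s_def t_def)
  have "(\<gamma> i j + \<gamma> j i) * (s * (R i * C i) + t * (R j * C j) - s * t * ((R i - R j) * (C i - C j)))
      = ((\<gamma> i j + \<gamma> j i) * s) * (R i * C i) + ((\<gamma> i j + \<gamma> j i) * t) * (R j * C j)
        - ((\<gamma> i j + \<gamma> j i) * s) * t * ((R i - R j) * (C i - C j))"
    by (simp only: distrib_left right_diff_distrib mult.assoc)
  also have "\<dots> = \<gamma> i j * (R i * C i) + \<gamma> j i * (R j * C j)
      - \<gamma> i j * \<gamma> j i / (\<gamma> i j + \<gamma> j i) * ((R i - R j) * (C i - C j))"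
    unfolding mult by (simp add: t_def)
  finally show "pair_weight \<gamma> e * (R (program_posterior \<gamma> e) * C (program_posterior \<gamma> e)) =
      pair_value A u \<mu> \<theta> \<gamma> e"
    unfolding post L(1) product_convex_combination[OF linear_likelihood_ratio linear_action_cost st(3)]
      L(2,3) unfolding e pair_weight_doubleton pair_value_doubleton by (simp only: mult.assoc)
qed

text \<open>Bridges the sums over the signals, which omit pairs of weight 0, and those of the
  program over all pairs.\<close>

lemma pair_weight_zero:
  assumes "\<gamma> \<in> nonneg" "e \<in> G" "e \<notin> program_signals A u \<mu> \<theta> \<gamma>"
  shows "pair_vector \<gamma> e = 0" and "pair_value A u \<mu> \<theta> \<gamma> e = 0"
proof -
  obtain i j where e: "e = {i, j}" using assms(2) by (auto elim: pairE)
  have "\<not> 0 < \<gamma> i j + \<gamma> j i"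
    using assms(2,3) by (simp add: program_signals_def e pair_weight_doubleton)
  moreover have "0 \<le> \<gamma> i j" "0 \<le> \<gamma> j i" using nonnegD[OF assms(1)] assms(2) e by auto
  ultimately have "\<gamma> i j = 0" "\<gamma> j i = 0" by linarith+
  then show "pair_vector \<gamma> e = 0" "pair_value A u \<mu> \<theta> \<gamma> e = 0"
    unfolding e pair_vector_doubleton pair_value_doubleton by simp_all
qed

lemma program_rule:
  assumes "\<gamma> \<in> feasible"
  defines "S \<equiv> program_signals A u \<mu> \<theta> \<gamma>"
    and "\<pi> \<equiv> scheme_of_data \<theta> (pair_weight \<gamma>) (program_posterior \<gamma>)"
    and "p \<equiv> prices_of_data A u (program_posterior \<gamma>)"
  shows "signaling_scheme S \<pi>" and "revenue A u \<mu> \<theta> S \<pi> p = objective \<gamma>"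
proof -
  let ?w = "pair_weight \<gamma>" and ?\<eta> = "program_posterior \<gamma>"
  have \<gamma>: "\<gamma> \<in> nonneg" and tot: "total_vector \<gamma> = \<theta>"
    using assms(1) by (auto simp: program_feasible_def)
  have SG: "S \<subseteq> G" by (auto simp: S_def program_signals_def)
  have w: "0 < ?w e" if "e \<in> S" for e using that by (auto simp: S_def program_signals_def)
  have bel: "?\<eta> e \<in> beliefs" if "e \<in> S" for e
    using pair_posterior(1)[OF \<gamma>] SG w that by blast
  have vec: "?w e * ?\<eta> e $ \<omega> = pair_vector \<gamma> e $ \<omega>" if "e \<in> S" for e \<omega>
    using w[OF that] by (simp add: program_posterior_def)
  have "(\<Sum>e\<in>S. pair_vector \<gamma> e) = total_vector \<gamma>"
    unfolding program_total_def
    by (rule sum.mono_neutral_left[OF finite_G SG]) (auto simp: S_def pair_weight_zero(1)[OF \<gamma>])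
  \<comment> \<open>The equality constraint, read coordinatewise, is what makes the scheme sum to 1
    in each state.\<close>
  then have sum_vec: "(\<Sum>e\<in>S. ?w e * ?\<eta> e $ \<omega>) = \<theta> $ \<omega>" for \<omega>
    by (simp add: vec tot flip: sum_component)
  show scheme: "signaling_scheme S \<pi>"
    unfolding signaling_scheme_def
  proof (intro conjI allI ballI)
    show "finite S" using SG finite_G finite_subset by blast
    fix \<omega>
    show "0 \<le> \<pi> \<omega> e" if "e \<in> S" for e
      using w[OF that] bel[OF that] prior_pos[of \<omega>]
      by (simp add: \<pi>_def scheme_of_data_def beliefs_def)
    show "(\<Sum>e\<in>S. \<pi> \<omega> e) = 1"
      using sum_vec[of \<omega>] prior_pos[of \<omega>]
      by (simp add: \<pi>_def scheme_of_data_def flip: sum_divide_distrib)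
  qed
  have joint: "\<theta> $ \<omega> * \<pi> \<omega> e = ?w e * ?\<eta> e $ \<omega>" for \<omega> e
    using prior_pos[of \<omega>] by (simp add: \<pi>_def scheme_of_data_def)
  have prob: "signal_prob \<theta> \<pi> e = ?w e" if "e \<in> S" for e
    using bel[OF that] by (simp add: signal_prob_def joint beliefs_def flip: sum_distrib_left)
  \<comment> \<open>Bayes' rule applied to the constructed scheme returns the intended
    mixtures.\<close>
  have post: "posterior \<theta> \<pi> e = ?\<eta> e" if "e \<in> S" for e
    using w[OF that] by (simp add: posterior_def prob[OF that] joint vec_eq_iff)
  have "revenue A u \<mu> \<theta> S \<pi> p = (\<Sum>e\<in>S. \<Sum>\<omega>\<in>UNIV. \<mu> $ \<omega> *
      (\<pi> \<omega> e * p e * of_bool (p e \<le> C (posterior \<theta> \<pi> e))))"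
    unfolding revenue_def sum_distrib_left by (rule sum.swap)
  also have "\<dots> = (\<Sum>e\<in>S. pair_value A u \<mu> \<theta> \<gamma> e)"
  proof (rule sum.cong[OF refl])
    fix e assume e: "e \<in> S"
    \<comment> \<open>The price equals the cost at the posterior, so the buyer purchases after every
      signal.\<close>
    have "p e \<le> C (posterior \<theta> \<pi> e)"
      by (simp add: post[OF e] p_def prices_of_data_def)
    then have "(\<Sum>\<omega>\<in>UNIV. \<mu> $ \<omega> * (\<pi> \<omega> e * p e * of_bool (p e \<le> C (posterior \<theta> \<pi> e))))
        = (\<Sum>\<omega>\<in>UNIV. \<mu> $ \<omega> * (\<pi> \<omega> e * p e))"
      by simp
    also have "\<dots> = ?w e * (R (?\<eta> e) * C (?\<eta> e))"
      by (simp add: p_def prices_of_data_def \<pi>_def scheme_of_data_def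
          likelihood_ratio_def sum_distrib_left sum_distrib_right mult_ac)
    also have "\<dots> = pair_value A u \<mu> \<theta> \<gamma> e"
      using pair_posterior(2)[OF \<gamma>] SG w[OF e] e by blast
    finally show "(\<Sum>\<omega>\<in>UNIV. \<mu> $ \<omega> * (\<pi> \<omega> e * p e * of_bool (p e \<le> C (posterior \<theta> \<pi> e))))
        = pair_value A u \<mu> \<theta> \<gamma> e" .
  qed
  also have "\<dots> = objective \<gamma>"
    unfolding program_objective_def
    by (rule sum.mono_neutral_left[OF finite_G SG]) (auto simp: S_def pair_weight_zero(2)[OF \<gamma>])
  finally show "revenue A u \<mu> \<theta> S \<pi> p = objective \<gamma>" .
qed

section \<open>Existence of a solution and optimality of its rule\<close>

text \<open>Vertices and \<open>\<theta>\<close> all have coordinate sum 1, so the equality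
  constraint forces the weights of all pairs to sum to 1. This is the bound behind
  compactness.\<close>

lemma feasible_le_1:
  assumes "\<gamma> \<in> feasible" "{i, j} \<in> G"
  shows "\<gamma> i j \<le> 1"
proof -
  have \<gamma>: "\<gamma> \<in> nonneg" and tot: "total_vector \<gamma> = \<theta>"
    using assms(1) by (auto simp: program_feasible_def)
  have mass: "(\<Sum>\<omega>\<in>UNIV. pair_vector \<gamma> e $ \<omega>) = pair_weight \<gamma> e \<and> 0 \<le> pair_weight \<gamma> e"
    if e_mem: "e \<in> G" for e
  proof -
    obtain x y a where e: "e = {x, y}" and "x \<in> region_vertices A u a" "y \<in> region_vertices A u a"
      using e_mem by (meson pairE)
    then have "x \<in> beliefs" "y \<in> beliefs"
      using region_vertices_subset[of A u a] best_region_subset_beliefs[of A u a] by auto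
    moreover have "0 \<le> \<gamma> x y" "0 \<le> \<gamma> y x" using nonnegD[OF \<gamma>] that e by auto
    ultimately show ?thesis
      by (simp add: e pair_vector_doubleton pair_weight_doubleton beliefs_def sum.distrib
          flip: sum_distrib_left)
  qed
  have "(\<Sum>e\<in>G. pair_weight \<gamma> e) = (\<Sum>e\<in>G. \<Sum>\<omega>\<in>UNIV. pair_vector \<gamma> e $ \<omega>)"
    by (rule sum.cong) (simp_all add: mass)
  also have "\<dots> = (\<Sum>\<omega>\<in>UNIV. total_vector \<gamma> $ \<omega>)"
    unfolding program_total_def sum_component by (rule sum.swap)
  also have "\<dots> = 1" using prior_beliefs by (simp add: tot beliefs_def)
  finally have "(\<Sum>e\<in>G. pair_weight \<gamma> e) = 1" .
  moreover have "pair_weight \<gamma> {i, j} \<le> (\<Sum>e\<in>G. pair_weight \<gamma> e)"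
    using mass by (intro member_le_sum assms(2) finite_G) auto
  moreover have "0 \<le> \<gamma> j i" using nonnegD[OF \<gamma> assms(2)] by simp
  ultimately show ?thesis by (simp add: pair_weight_doubleton)
qed

lemma feasible_nonempty: "feasible \<noteq> {}"
  using attainable_belief[OF prior_beliefs]
  by (auto simp: attainable_def program_feasible_def)

text \<open>A continuous function attains its maximum on a nonempty compact set. The variables
  outside \<open>G\<close> are unconstrained, so the feasible set itself need not be compact;
  \<open>restrict\<close> sets them to 0 without changing the constraint or the objective.\<close>

lemma program_solution_exists: "\<exists>\<gamma>. program_solution A u \<mu> \<theta> \<gamma>"
proof -
  define B :: "real ^ 'n \<Rightarrow> real ^ 'n \<Rightarrow> real set"
    where "B i j = (if {i, j} \<in> G then {0..1} else {0})" for i j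
  define Q where "Q = {\<gamma>. \<forall>i. \<gamma> i \<in> {f. \<forall>j. f j \<in> B i j}}"
  define K where "K = {\<gamma> \<in> Q. total_vector \<gamma> = \<theta>}"
  define restrict :: "(real ^ 'n \<Rightarrow> real ^ 'n \<Rightarrow> real) \<Rightarrow> real ^ 'n \<Rightarrow> real ^ 'n \<Rightarrow> real"
    where "restrict \<gamma> = (\<lambda>i j. if {i, j} \<in> G then \<gamma> i j else 0)" for \<gamma>
  have coord: "continuous_on X (\<lambda>\<gamma> :: real ^ 'n \<Rightarrow> real ^ 'n \<Rightarrow> real. \<gamma> i j)" for X i j
    by (rule continuous_on_product_then_coordinatewise[OF
          continuous_on_product_then_coordinatewise[OF continuous_on_id]])
  have Q_nonneg: "0 \<le> \<gamma> i j" if "\<gamma> \<in> Q" for \<gamma> i j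
  proof -
    have "\<gamma> i j \<in> B i j" using that by (auto simp: Q_def)
    then show ?thesis by (auto simp: B_def split: if_splits)
  qed
  \<comment> \<open>The product theorem is applied twice, once for each argument of the curried
    \<open>\<gamma>\<close>.\<close>
  have "compact Q"
    unfolding Q_def by (intro compact_pointwise) (simp add: B_def)
  have cont_total: "continuous_on UNIV total_vector"
    unfolding program_total_def
  proof (rule continuous_on_sum)
    fix e assume "e \<in> G"
    then obtain i j where e: "e = {i, j}" by (auto elim: pairE)
    show "continuous_on UNIV (\<lambda>\<gamma>. pair_vector \<gamma> e)"
      unfolding e pair_vector_doubleton by (intro continuous_intros coord)
  qed
  have "closed {\<gamma>. total_vector \<gamma> = \<theta>}"
    by (intro closed_Collect_eq cont_total continuous_on_const)
  with \<open>compact Q\<close> have "compact (Q \<inter> {\<gamma>. total_vector \<gamma> = \<theta>})" by (rule compact_Int_closed)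
  moreover have "K = Q \<inter> {\<gamma>. total_vector \<gamma> = \<theta>}" by (auto simp: K_def)
  ultimately have "compact K" by simp
  have cont_objective: "continuous_on K objective"
    unfolding program_objective_def
  proof (rule continuous_on_sum)
    fix e assume "e \<in> G"
    then obtain i j where e: "e = {i, j}" by (auto elim: pairE)
    show "continuous_on K (\<lambda>\<gamma>. pair_value A u \<mu> \<theta> \<gamma> e)"
      unfolding e pair_value_doubleton
      by (intro continuous_on_add continuous_on_diff continuous_on_mult continuous_on_const coord
          continuous_on_parallel_sum)
        (auto simp: K_def Q_nonneg)
  qed
  have same: "total_vector (restrict \<gamma>) = total_vector \<gamma>" "objective (restrict \<gamma>) = objective \<gamma>" for \<gamma>
  proof -
    have "pair_vector (restrict \<gamma>) e = pair_vector \<gamma> e \<and>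
        pair_value A u \<mu> \<theta> (restrict \<gamma>) e = pair_value A u \<mu> \<theta> \<gamma> e" if e_mem: "e \<in> G" for e
    proof -
      obtain i j where e: "e = {i, j}" using e_mem by (auto elim: pairE)
      then have "restrict \<gamma> i j = \<gamma> i j" "restrict \<gamma> j i = \<gamma> j i"
        using that by (auto simp: restrict_def insert_commute)
      then show ?thesis unfolding e pair_vector_doubleton pair_value_doubleton by simp
    qed
    then show "total_vector (restrict \<gamma>) = total_vector \<gamma>" "objective (restrict \<gamma>) = objective \<gamma>"
      by (simp_all add: program_total_def program_objective_def)
  qed
  have restrict: "restrict \<gamma> \<in> K" if "\<gamma> \<in> feasible" for \<gamma>
    using that feasible_le_1[OF that] same(1)[of \<gamma>]
    by (auto simp: K_def Q_def B_def restrict_def program_feasible_def program_nonneg_def)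
  then have "K \<noteq> {}" using feasible_nonempty by auto
  from continuous_attains_sup[OF \<open>compact K\<close> this cont_objective]
  obtain \<gamma> where "\<gamma> \<in> K" and max: "\<And>\<gamma>'. \<gamma>' \<in> K \<Longrightarrow> objective \<gamma>' \<le> objective \<gamma>" by blast
  moreover have "\<gamma> \<in> feasible"
    using \<open>\<gamma> \<in> K\<close> by (auto simp: K_def program_feasible_def program_nonneg_def Q_nonneg)
  ultimately have "program_solution A u \<mu> \<theta> \<gamma>"
    unfolding program_solution_def using restrict same(2) by metis
  then show ?thesis by blast
qed

text \<open>The revenue of any competitor is at most the objective of some feasible point, hence at
  most that of \<open>\<gamma>\<close>, which is the revenue of its own rule.\<close>

lemma program_solution_optimal:
  assumes "program_solution A u \<mu> \<theta> \<gamma>"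
  shows "optimal_rule TYPE('t) A u \<mu> \<theta>
    (program_signals A u \<mu> \<theta> \<gamma>)
    (scheme_of_data \<theta> (pair_weight \<gamma>) (program_posterior \<gamma>))
    (prices_of_data A u (program_posterior \<gamma>))"
  unfolding optimal_rule_def
proof (intro conjI allI impI)
  have \<gamma>: "\<gamma> \<in> feasible" using assms by (simp add: program_solution_def)
  show "signaling_scheme (program_signals A u \<mu> \<theta> \<gamma>)
      (scheme_of_data \<theta> (pair_weight \<gamma>) (program_posterior \<gamma>))"
    using program_rule(1)[OF \<gamma>] .
  fix S' :: "'t set" and \<pi>' :: "'n \<Rightarrow> 't \<Rightarrow> real" and p'
  assume "signaling_scheme S' \<pi>'"
  then obtain \<gamma>' where "\<gamma>' \<in> feasible" "revenue A u \<mu> \<theta> S' \<pi>' p' \<le> objective \<gamma>'"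
    using attainable_revenue[of S' \<pi>' p'] by (auto simp: attainable_def program_feasible_def)
  then show "revenue A u \<mu> \<theta> S' \<pi>' p' \<le> revenue A u \<mu> \<theta> (program_signals A u \<mu> \<theta> \<gamma>)
      (scheme_of_data \<theta> (pair_weight \<gamma>) (program_posterior \<gamma>))
      (prices_of_data A u (program_posterior \<gamma>))"
    unfolding program_rule(2)[OF \<gamma>] using assms by (auto simp: program_solution_def)
qed

end

theorem theorem3p2:
  fixes A :: "'a set" and u :: "'n::finite \<Rightarrow> 'a \<Rightarrow> real" and \<mu> \<theta> :: "real ^ 'n"
  assumes "finite A" and "A \<noteq> {}"
    and "\<And>\<omega> a. a \<in> A \<Longrightarrow> 0 \<le> u \<omega> a \<and> u \<omega> a \<le> 1"
    and "\<mu> \<in> beliefs"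
    and "\<theta> \<in> beliefs" and "\<And>\<omega>. 0 < \<theta> $ \<omega>"
  shows "concave_on (program_nonneg A u \<mu> \<theta>) (program_objective A u \<mu> \<theta>) \<and>
    linear (program_total A u \<mu> \<theta>) \<and>
    (\<exists>\<gamma>. program_solution A u \<mu> \<theta> \<gamma>) \<and>
    (\<forall>\<gamma>. program_solution A u \<mu> \<theta> \<gamma> \<longrightarrow>
       optimal_rule TYPE('t) A u \<mu> \<theta>
         (program_signals A u \<mu> \<theta> \<gamma>)
         (scheme_of_data \<theta> (pair_weight \<gamma>) (program_posterior \<gamma>))
         (prices_of_data A u (program_posterior \<gamma>)))"
proof -
  interpret advertising A u \<mu> \<theta>
    using assms by unfold_locales
  show ?thesis
    using concave_objective linear_total_vector program_solution_exists program_solution_optimal by blast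
qed

end
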